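(* Let $X$ be a non-empty set, $(S,\cdot,0)$ a commutative semigroup with zero, and $f$ a function from $X$ to $S$ with the property that for all $x,y\in X$, if $f(x)f(y)\neq 0$ then there exists a $z\in X$ such that $f(z)=f(x)f(y)$. If the graph $\Gamma_{(S,f)}(X)$ is non-empty, then it is connected and $\operatorname{diam}(\Gamma_{(S,f)}(X))\leq 3$.
   Context: A commutative semigroup with zero $(S,\cdot,0)$ is a commutative multiplicative semigroup with an element $0$ satisfying $0\cdot s=0$ for all $s\in S$. Given a non-empty set $X$ and a function $f:X\to S$, the simple graph $\Gamma_{(S,f)}(X)$ is defined as follows. An element $x\in X$ is a vertex if $f(x)\neq 0$ and there is a $y\in X$ with $y\neq x$, $f(y)\neq 0$ and $f(x)\cdot f(y)=0$. For $x,y\in X$, $\{x,y\}$ is an edge if $x\neq y$, $f(x)\neq 0$, $f(y)\neq 0$ and $f(x)\cdot f(y)=0$. The graph is non-empty if it has at least one vertex. The distance between two vertices is the number of edges in a shortest path connecting them, and the diameter $\operatorname{diam}$ is the greatest distance between any two vertices. *)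

theory Defs
  imports "Graph_Theory.Graph_Theory" "HOL-Library.Extended_Nat"
begin

text \<open>
  Graphs are symmetric digraphs, as in \<^theory>\<open>Graph_Theory.Digraph\<close>: an edge \<open>{x, y}\<close> is
  the pair of arcs \<open>(x, y)\<close>, \<open>(y, x)\<close>. The sort of \<^typ>\<open>'s\<close> says precisely that it is a
  commutative semigroup with zero (no unit, no addition).
\<close>

definition Gamma_graph :: "('x \<Rightarrow> 's :: {ab_semigroup_mult, mult_zero}) \<Rightarrow> 'x set \<Rightarrow> 'x pair_pre_digraph"
  where
  "Gamma_graph f X =
     \<lparr> pverts = {x \<in> X. f x \<noteq> 0 \<and> (\<exists>y\<in>X. y \<noteq> x \<and> f y \<noteq> 0 \<and> f x * f y = 0)},
       parcs = {(x, y). x \<in> X \<and> y \<in> X \<and> x \<noteq> y \<and> f x \<noteq> 0 \<and> f y \<noteq> 0 \<and> f x * f y = 0} \<rparr>"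

lemma pair_bidirected_digraph_Gamma_graph: "pair_bidirected_digraph (Gamma_graph f X)"
proof
  fix e assume "e \<in> parcs (Gamma_graph f X)"
  then show "fst e \<in> pverts (Gamma_graph f X)" "snd e \<in> pverts (Gamma_graph f X)" "fst e \<noteq> snd e"
    unfolding Gamma_graph_def by (auto, (metis mult.commute)+)
next
  show "symmetric (Gamma_graph f X)"
    by (auto simp: Gamma_graph_def symmetric_def mult.commute intro!: symI)
qed

text \<open>
  The infimum over the empty set is \<open>\<infinity>\<close>, so vertices not joined by a path have distance \<open>\<infinity>\<close>;
  otherwise the infimum is attained by a shortest path. The diameter is \<open>\<infinity>\<close> if the distances
  are unbounded; otherwise, for a graph with a vertex, the supremum is a maximum.
\<close>

definition graph_dist :: "('a, 'b) pre_digraph \<Rightarrow> 'a \<Rightarrow> 'a \<Rightarrow> enat" where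
  "graph_dist G u v = (INF p \<in> {p. pre_digraph.apath G u p v}. enat (length p))"

definition graph_diam :: "('a, 'b) pre_digraph \<Rightarrow> enat" where
  "graph_diam G = (SUP u \<in> verts G. SUP v \<in> verts G. graph_dist G u v)"

end

theory Submission
  imports Defs
begin

text \<open>
  Any two vertices \<open>u \<noteq> v\<close> are joined by a path with at most three edges, which gives both
  connectedness and the bound on the diameter. If \<open>f u * f v = 0\<close>, then \<open>u\<close> and \<open>v\<close> are adjacent.
  Otherwise pick a neighbour \<open>a\<close> of \<open>u\<close> and a neighbour \<open>b\<close> of \<open>v\<close>. If \<open>a = b\<close>, then \<open>u, a, v\<close>
  is a path. If \<open>a \<noteq> b\<close> and \<open>f a * f b = 0\<close>, then \<open>u, a, b, v\<close> is a path. If \<open>f a * f b \<noteq> 0\<close>, the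
  closure hypothesis supplies \<open>z\<close> with \<open>f z = f a * f b\<close>; the factor \<open>f a\<close> makes \<open>f z\<close>
  annihilate \<open>f u\<close>, and the factor \<open>f b\<close> makes it annihilate \<open>f v\<close>, so \<open>u, z, v\<close> is a path.

  The vertices on these paths are distinct although \<open>f\<close> may fail to be injective and its values
  may square to zero: \<open>f a\<close> and \<open>f z\<close> annihilate \<open>f u\<close>, and \<open>f b\<close> and \<open>f z\<close> annihilate \<open>f v\<close>,
  whereas \<open>f u * f v \<noteq> 0\<close>. Hence \<open>a \<noteq> v\<close>, \<open>b \<noteq> u\<close>, and \<open>z\<close> is neither \<open>u\<close> nor \<open>v\<close>.
\<close>

lemma pverts_Gamma_graph_iff:
  "x \<in> pverts (Gamma_graph f X) \<longleftrightarrow> (\<exists>y. (x, y) \<in> parcs (Gamma_graph f X))"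
  by (auto simp: Gamma_graph_def)

lemma parcs_Gamma_graph_iff:
  "(x, y) \<in> parcs (Gamma_graph f X) \<longleftrightarrow>
     x \<in> X \<and> y \<in> X \<and> x \<noteq> y \<and> f x \<noteq> 0 \<and> f y \<noteq> 0 \<and> f x * f y = 0"
  by (simp add: Gamma_graph_def)

text \<open>
  By associativity \<open>f a * f b\<close> annihilates \<open>f u\<close> through its first factor and \<open>f v\<close> through its
  second. This is the only place where closure of the values of \<open>f\<close> under nonzero products enters:
  it supplies the element \<open>z\<close>.
\<close>

lemma Gamma_graph_common_neighbour:
  fixes f :: "'x \<Rightarrow> 's :: {ab_semigroup_mult, mult_zero}"
  assumes ua: "(u, a) \<in> parcs (Gamma_graph f X)" and bv: "(b, v) \<in> parcs (Gamma_graph f X)"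
    and uv: "f u * f v \<noteq> 0" and ab: "f a * f b \<noteq> 0"
    and z: "z \<in> X" "f z = f a * f b"
  shows "(u, z) \<in> parcs (Gamma_graph f X)" and "(z, v) \<in> parcs (Gamma_graph f X)"
proof -
  have "f u * f z = (f u * f a) * f b"
    by (simp add: z mult.assoc)
  then have uz: "f u * f z = 0"
    using ua by (simp add: parcs_Gamma_graph_iff)
  have "f z * f v = f a * (f b * f v)"
    by (simp add: z mult.assoc)
  then have zv: "f z * f v = 0"
    using bv by (simp add: parcs_Gamma_graph_iff)
  \<comment> \<open>If \<open>z\<close> were \<open>u\<close> or \<open>v\<close>, one of the two vanishing products would be \<open>f u * f v\<close>.\<close>
  have "z \<noteq> u" "z \<noteq> v"
    using uz zv uv by auto
  with ua bv ab z uz zv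
  show "(u, z) \<in> parcs (Gamma_graph f X)" and "(z, v) \<in> parcs (Gamma_graph f X)"
    by (auto simp: parcs_Gamma_graph_iff)
qed

lemma Gamma_graph_short_apath:
  fixes f :: "'x \<Rightarrow> 's :: {ab_semigroup_mult, mult_zero}"
  assumes closed: "\<forall>x\<in>X. \<forall>y\<in>X. f x * f y \<noteq> 0 \<longrightarrow> (\<exists>z\<in>X. f z = f x * f y)"
    and u: "u \<in> pverts (Gamma_graph f X)" and v: "v \<in> pverts (Gamma_graph f X)"
  shows "\<exists>p. pre_digraph.apath (Gamma_graph f X) u p v \<and> length p \<le> 3"
proof -
  interpret G: pair_bidirected_digraph "Gamma_graph f X"
    by (rule pair_bidirected_digraph_Gamma_graph)
  obtain a where ua: "(u, a) \<in> parcs (Gamma_graph f X)"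
    using u by (auto simp: pverts_Gamma_graph_iff)
  obtain b where vb: "(v, b) \<in> parcs (Gamma_graph f X)"
    using v by (auto simp: pverts_Gamma_graph_iff)
  have bv: "(b, v) \<in> parcs (Gamma_graph f X)"
    using vb by (auto simp: parcs_Gamma_graph_iff mult.commute)
  consider (same) "u = v"
    | (adjacent) "u \<noteq> v" "f u * f v = 0"
    | (apart) "u \<noteq> v" "f u * f v \<noteq> 0" by blast
  then show ?thesis
  proof cases
    case same
    then have "G.apath u [] v"
      using u by (simp add: G.apath_Nil_iff)
    then show ?thesis by force
  next
    case adjacent
    then have "G.apath u [(u, v)] v"
      using ua bv v by (auto simp: G.apath_simps parcs_Gamma_graph_iff)
    then show ?thesis by force
  next
    case apart
    have common: ?thesis
      if "(u, c) \<in> parcs (Gamma_graph f X)" "(c, v) \<in> parcs (Gamma_graph f X)" for c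
    proof -
      have "G.apath u [(u, c), (c, v)] v"
        using that apart v by (auto simp: G.apath_simps parcs_Gamma_graph_iff)
      then show ?thesis by force
    qed
    show ?thesis
    proof (cases "f a * f b = 0")
      case False
      then obtain z where "z \<in> X" "f z = f a * f b"
        using closed ua bv by (auto simp: parcs_Gamma_graph_iff)
      then show ?thesis
        using Gamma_graph_common_neighbour[OF ua bv apart(2) False] common by blast
    next
      case True
      show ?thesis
      proof (cases "a = b")
        case True
        then show ?thesis using common ua bv by blast
      next
        case False
        \<comment> \<open>\<open>a = v\<close> or \<open>b = u\<close> would make \<open>u\<close> and \<open>v\<close> adjacent.\<close>
        have "a \<noteq> v" "b \<noteq> u"
          using apart ua bv by (auto simp: parcs_Gamma_graph_iff)
        moreover have "(a, b) \<in> parcs (Gamma_graph f X)"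
          using True False ua bv by (simp add: parcs_Gamma_graph_iff)
        ultimately have "G.apath u [(u, a), (a, b), (b, v)] v"
          using ua bv v apart by (auto simp: G.apath_simps parcs_Gamma_graph_iff)
        then show ?thesis by force
      qed
    qed
  qed
qed

lemma graph_dist_le_length:
  "pre_digraph.apath G u p v \<Longrightarrow> graph_dist G u v \<le> enat (length p)"
  unfolding graph_dist_def by (rule INF_lower) simp

theorem theorem3p1:
  fixes X :: "'x set" and f :: "'x \<Rightarrow> 's :: {ab_semigroup_mult, mult_zero}"
  assumes "X \<noteq> {}"
    and "\<forall>x\<in>X. \<forall>y\<in>X. f x * f y \<noteq> 0 \<longrightarrow> (\<exists>z\<in>X. f z = f x * f y)"
    and "verts (Gamma_graph f X) \<noteq> {}"
  shows "Digraph_Component.connected (Gamma_graph f X) \<and> graph_diam (Gamma_graph f X) \<le> 3"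
proof
  interpret G: pair_bidirected_digraph "Gamma_graph f X"
    by (rule pair_bidirected_digraph_Gamma_graph)
  note path = Gamma_graph_short_apath[OF assms(2)]
  show "Digraph_Component.connected (Gamma_graph f X)"
    unfolding Digraph_Component.connected_def
  proof (rule strongly_connectedI)
    show "verts (mk_symmetric (Gamma_graph f X)) \<noteq> {}"
      using assms(3) by simp
    fix u v
    assume "u \<in> verts (mk_symmetric (Gamma_graph f X))" "v \<in> verts (mk_symmetric (Gamma_graph f X))"
    then have "u \<rightarrow>\<^sup>*\<^bsub>with_proj (Gamma_graph f X)\<^esub> v"
      using path[of u v] by (auto simp: G.reachable_apath)
    then show "u \<rightarrow>\<^sup>*\<^bsub>with_proj (mk_symmetric (Gamma_graph f X))\<^esub> v"
      by (rule G.reachable_mk_symmetricI)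
  qed
  have "graph_dist (Gamma_graph f X) u v \<le> 3"
    if uv: "u \<in> verts (Gamma_graph f X)" "v \<in> verts (Gamma_graph f X)" for u v
  proof -
    obtain p where "G.apath u p v" "length p \<le> 3"
      using path[of u v] uv by auto
    then have "graph_dist (Gamma_graph f X) u v \<le> enat (length p)"
      by (simp add: graph_dist_le_length)
    also have "\<dots> \<le> enat 3"
      using \<open>length p \<le> 3\<close> by simp
    finally show ?thesis by (simp add: numeral_eq_enat)
  qed
  then show "graph_diam (Gamma_graph f X) \<le> 3"
    unfolding graph_diam_def by (intro SUP_least)
qed

end
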